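(* Let $r,t\in\mathcal{U}$, $s\in\mathcal{U}_0$, and let $p=(p_n)_{n\ge0}$ be a bounded sequence of strictly positive real numbers. If $p_n>1$ for each $n$, then the space $l(r,s,t,p;\Delta)$, equipped with the Luxemburg norm, is rotund.
   Context: Let $w$ be the space of all real (or complex) sequences $x=(x_n)_{n\in\mathbb{N}_0}$; $\mathcal{U}=\{u\in w:u_n\ne0\ \forall n\}$, $\mathcal{U}_0=\{u\in w:u_0\ne0\}$. Put $\Delta x_k=x_k-x_{k-1}$ with $x_{-1}=0$, and $$\sigma_p(x)=\sum_{n=0}^\infty\Big|\frac1{r_n}\sum_{k=0}^ns_{n-k}t_k\Delta x_k\Big|^{p_n},\qquad l(r,s,t,p;\Delta)=\{x\in w:\sigma_p(x)<\infty\}.$$ The Luxemburg norm is $\|x\|=\inf\{c>0:\sigma_p(x/c)\le1\}$. For a Banach space $Y$ with unit sphere $S(Y)$, a point $x\in S(Y)$ is an extreme point if $x=\frac{y+z}2$ with $y,z\in S(Y)$ implies $y=z$; $Y$ is rotund (strictly convex) if every point of $S(Y)$ is an extreme point. *)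

theory Defs
  imports "HOL-Analysis.Analysis" "HOL-Library.Function_Algebras"
begin

text \<open>Banach spaces are given by a carrier set \<open>Y\<close> inside an ambient vector space, since the
  sequence spaces below depend on term parameters.\<close>

definition normed_space_on ::
  "('k::real_normed_field \<Rightarrow> 'v::ab_group_add \<Rightarrow> 'v) \<Rightarrow> 'v set \<Rightarrow> ('v \<Rightarrow> real) \<Rightarrow> bool" where
  "normed_space_on smul Y N \<longleftrightarrow>
     vector_space smul \<and> module.subspace smul Y \<and>
     (\<forall>x\<in>Y. 0 \<le> N x) \<and>
     (\<forall>x\<in>Y. N x = 0 \<longleftrightarrow> x = 0) \<and>
     (\<forall>c. \<forall>x\<in>Y. N (smul c x) = norm c * N x) \<and>
     (\<forall>x\<in>Y. \<forall>y\<in>Y. N (x + y) \<le> N x + N y)"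

definition banach_space_on ::
  "('k::real_normed_field \<Rightarrow> 'v::ab_group_add \<Rightarrow> 'v) \<Rightarrow> 'v set \<Rightarrow> ('v \<Rightarrow> real) \<Rightarrow> bool" where
  "banach_space_on smul Y N \<longleftrightarrow>
     normed_space_on smul Y N \<and>
     (\<forall>X :: nat \<Rightarrow> 'v.
        (\<forall>i. X i \<in> Y) \<and> (\<forall>e>0. \<exists>K. \<forall>i\<ge>K. \<forall>j\<ge>K. N (X i - X j) < e) \<longrightarrow>
        (\<exists>x\<in>Y. (\<lambda>i. N (X i - x)) \<longlonglongrightarrow> 0))"

definition unit_sphere_on :: "'v set \<Rightarrow> ('v \<Rightarrow> real) \<Rightarrow> 'v set" where
  "unit_sphere_on Y N = {x \<in> Y. N x = 1}"

definition extreme_point_on ::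
  "('k::real_normed_field \<Rightarrow> 'v::ab_group_add \<Rightarrow> 'v) \<Rightarrow> 'v set \<Rightarrow> ('v \<Rightarrow> real) \<Rightarrow> 'v \<Rightarrow> bool" where
  "extreme_point_on smul Y N x \<longleftrightarrow>
     x \<in> unit_sphere_on Y N \<and>
     (\<forall>y\<in>unit_sphere_on Y N. \<forall>z\<in>unit_sphere_on Y N. x = smul (1/2) (y + z) \<longrightarrow> y = z)"

text \<open>Rotundity is a property of Banach spaces, so being a Banach space is part of it.\<close>

definition rotund_on ::
  "('k::real_normed_field \<Rightarrow> 'v::ab_group_add \<Rightarrow> 'v) \<Rightarrow> 'v set \<Rightarrow> ('v \<Rightarrow> real) \<Rightarrow> bool" where
  "rotund_on smul Y N \<longleftrightarrow>
     banach_space_on smul Y N \<and>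
     (\<forall>x\<in>unit_sphere_on Y N. extreme_point_on smul Y N x)"

definition seq_U :: "(nat \<Rightarrow> 'a::zero) set" where
  "seq_U = {u. \<forall>n. u n \<noteq> 0}"

definition seq_U0 :: "(nat \<Rightarrow> 'a::zero) set" where
  "seq_U0 = {u. u 0 \<noteq> 0}"

definition seq_scale :: "'a::times \<Rightarrow> (nat \<Rightarrow> 'a) \<Rightarrow> (nat \<Rightarrow> 'a)" where
  "seq_scale c x = (\<lambda>k. c * x k)"

definition seq_diff :: "(nat \<Rightarrow> 'a::ab_group_add) \<Rightarrow> nat \<Rightarrow> 'a" where
  "seq_diff x k = x k - (if k = 0 then 0 else x (k - 1))"

text \<open>The modular takes values in \<open>[0, \<infinity>]\<close>, so a divergent series has the value \<open>\<infinity>\<close>.\<close>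

definition modular_p ::
  "(nat \<Rightarrow> 'a::real_normed_field) \<Rightarrow> (nat \<Rightarrow> 'a) \<Rightarrow> (nat \<Rightarrow> 'a) \<Rightarrow> (nat \<Rightarrow> real) \<Rightarrow>
   (nat \<Rightarrow> 'a) \<Rightarrow> ennreal" where
  "modular_p r s t p x =
     (\<Sum>n. ennreal (norm (1 / r n * (\<Sum>k=0..n. s (n - k) * t k * seq_diff x k)) powr p n))"

definition l_space ::
  "(nat \<Rightarrow> 'a::real_normed_field) \<Rightarrow> (nat \<Rightarrow> 'a) \<Rightarrow> (nat \<Rightarrow> 'a) \<Rightarrow> (nat \<Rightarrow> real) \<Rightarrow>
   (nat \<Rightarrow> 'a) set" where
  "l_space r s t p = {x. modular_p r s t p x < \<infinity>}"

definition luxemburg_norm ::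
  "(nat \<Rightarrow> 'a::real_normed_field) \<Rightarrow> (nat \<Rightarrow> 'a) \<Rightarrow> (nat \<Rightarrow> 'a) \<Rightarrow> (nat \<Rightarrow> real) \<Rightarrow>
   (nat \<Rightarrow> 'a) \<Rightarrow> real" where
  "luxemburg_norm r s t p x =
     Inf {c. 0 < c \<and> modular_p r s t p (\<lambda>k. x k / of_real c) \<le> 1}"

text \<open>The scalars are real or complex: \<^typ>\<open>real\<close> and \<^typ>\<open>complex\<close> are both of sort
  \<open>{real_normed_field, euclidean_space}\<close>, and by the Gelfand--Mazur theorem every type of this
  sort is isometrically isomorphic, as a real normed field, to one of them.\<close>

end

theory Submission
  imports Defs
begin

text \<open>The triangular matrix \<open>A\<^sub>n\<^sub>k = s\<^sub>n\<^sub>-\<^sub>k t\<^sub>k / r\<^sub>n\<close> composed with the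
  difference operator is a linear bijection of the space of all sequences, and it carries
  \<open>l(r,s,t,p;\<Delta>)\<close> with its Luxemburg norm onto the variable exponent space
  \<open>l(p)\<close>; so it is enough to treat the latter. Since \<open>p\<close> is bounded, every point
  of the unit sphere of \<open>l(p)\<close> has modular exactly one. If \<open>y\<close>, \<open>z\<close> and
  their midpoint all lie on the sphere, the termwise convexity inequalities between the three modulars
  are therefore equalities, and the strict convexity of \<open>\<bar>\<cdot>\<bar>\<^sup>p\<close> for
  \<open>p > 1\<close> gives \<open>y = z\<close>.\<close>

section \<open>Strict convexity of powers of the norm\<close>

text \<open>Strict Bernoulli inequality. By the mean value theorem \<open>x powr p - p * x\<close>
  decreases strictly on (0,1) and increases strictly beyond 1. The derivative formula is established
  for positive arguments only, so \<open>v = 0\<close> is treated apart.\<close>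

lemma powr_gt_tangent_one:
  fixes v p :: real
  assumes "1 < p" "0 \<le> v" "v \<noteq> 1"
  shows "1 + p * (v - 1) < v powr p"
proof (cases "v = 0")
  case True
  then show ?thesis using assms by simp
next
  case False
  define g where "g = (\<lambda>x::real. x powr p - p * x)"
  have der: "(g has_real_derivative p * (x powr (p - 1) - 1)) (at x)" if "0 < x" for x
    unfolding g_def using that
    by (auto intro!: derivative_eq_intros simp: algebra_simps)
  have "g 1 < g v"
  proof (cases "v < 1")
    case True
    obtain z where z: "v < z" "z < 1" "g 1 - g v = (1 - v) * (p * (z powr (p - 1) - 1))"
      using MVT2[of v 1 g "\<lambda>x. p * (x powr (p - 1) - 1)"] True der assms(2) False by force
    have "z powr (p - 1) < 1"
      using powr_less_mono2[of "p - 1" z 1] z assms by simp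
    then have "(1 - v) * (p * (z powr (p - 1) - 1)) < 0"
      using True assms by (simp add: mult_pos_neg)
    then show ?thesis using z(3) by simp
  next
    case False
    obtain z where z: "1 < z" "z < v" "g v - g 1 = (v - 1) * (p * (z powr (p - 1) - 1))"
      using MVT2[of 1 v g "\<lambda>x. p * (x powr (p - 1) - 1)"] False der assms(3) by force
    have "1 < z powr (p - 1)"
      using powr_less_mono2[of "p - 1" 1 z] z assms by simp
    then have "0 < (v - 1) * (p * (z powr (p - 1) - 1))"
      using False assms by simp
    then show ?thesis using z(3) by simp
  qed
  then show ?thesis by (simp add: g_def algebra_simps)
qed

text \<open>Bernoulli's inequality at \<open>x / m\<close>, multiplied by \<open>m powr p\<close>;
  the left side is the tangent line at \<open>m\<close>, evaluated at \<open>x\<close>.\<close>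

lemma powr_gt_tangent:
  fixes x m p :: real
  assumes "1 < p" "0 \<le> x" "0 < m" "x \<noteq> m"
  shows "m powr p + m powr p * p * (x / m - 1) < x powr p"
proof -
  have "1 + p * (x / m - 1) < (x / m) powr p"
    using assms by (intro powr_gt_tangent_one) auto
  then have "m powr p * (1 + p * (x / m - 1)) < m powr p * (x / m) powr p"
    using assms by (intro mult_strict_left_mono) auto
  also have "\<dots> = x powr p"
    using assms by (simp add: powr_divide)
  finally show ?thesis by (simp add: algebra_simps)
qed

lemma powr_ge_tangent:
  fixes x m p :: real
  assumes "1 < p" "0 \<le> x" "0 < m"
  shows "m powr p + m powr p * p * (x / m - 1) \<le> x powr p"
  using powr_gt_tangent[of p x m] assms by (cases "x = m") auto

text \<open>Jensen's inequality from a supporting line: the tangent at \<open>a * x + b * y\<close>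
  lies below the graph at \<open>x\<close> and \<open>y\<close>, and the weighted mean of its two
  values is its value at the point of contact.\<close>

lemma powr_convex_comb_le:
  fixes x y a b p :: real
  assumes "1 < p" "0 \<le> x" "0 \<le> y" "0 \<le> a" "0 \<le> b" "a + b = 1"
  shows "(a * x + b * y) powr p \<le> a * x powr p + b * y powr p"
proof (cases "a * x + b * y = 0")
  case True
  then show ?thesis using assms by simp
next
  case False
  define m where "m = a * x + b * y"
  have m: "0 < m" using False assms unfolding m_def by (metis add_nonneg_nonneg mult_nonneg_nonneg order_le_less)
  have "a * (m powr p + m powr p * p * (x / m - 1)) + b * (m powr p + m powr p * p * (y / m - 1))
      = (a + b) * m powr p + m powr p * p * ((a * x + b * y) / m - (a + b))"
    by (simp add: algebra_simps add_divide_distrib)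
  also have "\<dots> = m powr p"
    using m assms(6) by (simp add: m_def)
  finally have eq: "a * (m powr p + m powr p * p * (x / m - 1))
      + b * (m powr p + m powr p * p * (y / m - 1)) = m powr p" .
  have "a * (m powr p + m powr p * p * (x / m - 1)) \<le> a * x powr p"
    using assms m by (intro mult_left_mono powr_ge_tangent) auto
  moreover have "b * (m powr p + m powr p * p * (y / m - 1)) \<le> b * y powr p"
    using assms m by (intro mult_left_mono powr_ge_tangent) auto
  ultimately show ?thesis using eq by (simp add: m_def)
qed

text \<open>The tangent at the midpoint lies strictly below the graph at both ends, and the two
  slope terms cancel.\<close>

lemma powr_midpoint_less:
  fixes x y p :: real
  assumes "1 < p" "0 \<le> x" "0 \<le> y" "x \<noteq> y"
  shows "((x + y) / 2) powr p < (x powr p + y powr p) / 2"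
proof -
  define m where "m = (x + y) / 2"
  have m: "0 < m" "x \<noteq> m" "y \<noteq> m" using assms by (auto simp: m_def)
  have "m powr p + m powr p * p * (x / m - 1) < x powr p"
    "m powr p + m powr p * p * (y / m - 1) < y powr p"
    using powr_gt_tangent assms m by auto
  moreover have "m powr p * p * (x / m - 1) + m powr p * p * (y / m - 1)
      = m powr p * p * ((x + y) / m - 2)"
    by (simp add: algebra_simps add_divide_distrib)
  moreover have "(x + y) / m = 2" using m(1) by (simp add: m_def field_simps)
  ultimately show ?thesis unfolding m_def by simp
qed

text \<open>Equality in the triangle inequality of an inner product space means
  \<open>norm x *\<^sub>R y = norm y *\<^sub>R x\<close>; with equal norms this forces
  \<open>x = y\<close>.\<close>

lemma norm_midpoint_less:
  fixes x y :: "'a::real_inner"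
  assumes "norm x = norm y" "x \<noteq> y"
  shows "norm (x + y) < norm x + norm y"
proof -
  have "norm (x + y) \<noteq> norm x + norm y"
    using assms by (metis norm_eq_zero norm_triangle_eq scaleR_cancel_left)
  then show ?thesis using norm_triangle_ineq[of x y] by simp
qed

text \<open>Strictness has two sources: for equal norms the triangle inequality is strict, for
  different norms the power function is strictly convex.\<close>

lemma norm_powr_midpoint_less:
  fixes x y :: "'a::{real_normed_field,real_inner}"
  assumes "1 < p" "x \<noteq> y"
  shows "norm ((x + y) / 2) powr p < (norm x powr p + norm y powr p) / 2"
proof (cases "norm x = norm y")
  case True
  then have "norm ((x + y) / 2) < norm x"
    using norm_midpoint_less[OF True assms(2)] by (simp add: norm_divide)
  then have "norm ((x + y) / 2) powr p < norm x powr p"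
    using assms by (intro powr_less_mono2) auto
  then show ?thesis using True by simp
next
  case False
  have "norm ((x + y) / 2) powr p \<le> ((norm x + norm y) / 2) powr p"
    using assms norm_triangle_ineq[of x y] by (intro powr_mono2) (auto simp: norm_divide)
  also have "\<dots> < (norm x powr p + norm y powr p) / 2"
    using assms False by (intro powr_midpoint_less) auto
  finally show ?thesis .
qed

section \<open>The variable exponent sequence space\<close>

text \<open>The modular of the Nakano space with exponents \<open>p\<close>; for constant
  \<open>p\<close> it is the \<open>p\<close>-th power of the usual norm of that sequence
  space.\<close>

definition exp_modular :: "(nat \<Rightarrow> real) \<Rightarrow> (nat \<Rightarrow> 'a::real_normed_field) \<Rightarrow> ennreal" where
  "exp_modular p u = (\<Sum>n. ennreal (norm (u n) powr p n))"

definition exp_space :: "(nat \<Rightarrow> real) \<Rightarrow> (nat \<Rightarrow> 'a::real_normed_field) set" where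
  "exp_space p = {u. exp_modular p u < \<infinity>}"

definition exp_norm :: "(nat \<Rightarrow> real) \<Rightarrow> (nat \<Rightarrow> 'a::real_normed_field) \<Rightarrow> real" where
  "exp_norm p u = Inf {c. 0 < c \<and> exp_modular p (\<lambda>n. u n / of_real c) \<le> 1}"

lemma vector_space_seq_scale: "vector_space (seq_scale :: 'a::field \<Rightarrow> _)"
  by unfold_locales (auto simp: seq_scale_def fun_eq_iff algebra_simps)

lemma subspace_seq_scale_iff:
  "module.subspace (seq_scale :: 'a::field \<Rightarrow> _) Y \<longleftrightarrow>
    0 \<in> Y \<and> (\<forall>x\<in>Y. \<forall>y\<in>Y. x + y \<in> Y) \<and> (\<forall>c. \<forall>x\<in>Y. seq_scale c x \<in> Y)"
proof -
  interpret vector_space "seq_scale :: 'a \<Rightarrow> _" by (rule vector_space_seq_scale)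
  show ?thesis by (rule subspace_def)
qed

text \<open>The bound \<open>M\<close> is a parameter because it serves as a uniform exponent when
  sequences are rescaled.\<close>

locale bounded_exponent =
  fixes p :: "nat \<Rightarrow> real" and M :: real
  assumes p_gt_1: "1 < p n" and p_le: "p n \<le> M"
begin

lemma p_pos: "0 < p n"
  using p_gt_1[of n] by simp

lemma M_pos: "0 < M"
  using p_gt_1[of 0] p_le[of 0] by simp

section \<open>Monotonicity, scaling and convexity of the modular\<close>

lemma modular_mono:
  assumes "\<And>n. norm (u n) \<le> norm (v n)"
  shows "exp_modular p u \<le> exp_modular p v"
  unfolding exp_modular_def
  by (intro suminf_le summableI ennreal_leI powr_mono2) (auto simp: assms less_imp_le[OF p_pos])

lemma modular_term_le: "ennreal (norm (u n) powr p n) \<le> exp_modular p u"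
proof -
  have "(\<Sum>i\<in>{n}. ennreal (norm (u i) powr p i)) \<le> exp_modular p u"
    unfolding exp_modular_def by (rule sum_le_suminf) (auto intro: summableI)
  then show ?thesis by simp
qed

lemma norm_le_1_if_modular_le_1:
  assumes "exp_modular p u \<le> 1"
  shows "norm (u n) \<le> 1"
proof (rule ccontr)
  assume "\<not> ?thesis"
  then have "1 < norm (u n) powr p n"
    using powr_less_mono2[of "p n" 1 "norm (u n)"] p_pos by simp
  then have "1 < ennreal (norm (u n) powr p n)" by simp
  also have "\<dots> \<le> 1" using modular_term_le assms by (rule order_trans)
  finally show False by simp
qed

text \<open>For \<open>1 \<le> c\<close> every factor \<open>c powr p n\<close> is at most
  \<open>c powr M\<close>, so one constant serves all terms of the series.\<close>

lemma modular_scale_ge_1: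
  assumes "\<And>n. norm (v n) \<le> c * norm (u n)" "1 \<le> c"
  shows "exp_modular p v \<le> ennreal (c powr M) * exp_modular p u"
proof -
  have "norm (v n) powr p n \<le> c powr M * norm (u n) powr p n" for n
  proof -
    have "norm (v n) powr p n \<le> (c * norm (u n)) powr p n"
      using assms less_imp_le[OF p_pos] by (intro powr_mono2) auto
    also have "\<dots> = c powr p n * norm (u n) powr p n"
      using assms by (simp add: powr_mult)
    also have "\<dots> \<le> c powr M * norm (u n) powr p n"
      using assms p_le by (intro mult_right_mono powr_mono) auto
    finally show ?thesis .
  qed
  then show ?thesis
    unfolding exp_modular_def ennreal_suminf_cmult[symmetric]
    by (intro suminf_le summableI) (simp add: ennreal_mult[symmetric] ennreal_leI)
qed

text \<open>Convexity holds term by term. Asking only for domination of \<open>w\<close> lets the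
  triangle inequality be absorbed into the hypothesis.\<close>

lemma modular_convex:
  assumes "0 \<le> a" "0 \<le> b" "a + b = 1" "\<And>n. norm (w n) \<le> a * norm (u n) + b * norm (v n)"
  shows "exp_modular p w \<le> ennreal a * exp_modular p u + ennreal b * exp_modular p v"
proof -
  have "norm (w n) powr p n \<le> a * norm (u n) powr p n + b * norm (v n) powr p n" for n
  proof -
    have "norm (w n) powr p n \<le> (a * norm (u n) + b * norm (v n)) powr p n"
      using assms less_imp_le[OF p_pos] by (intro powr_mono2) auto
    also have "\<dots> \<le> a * norm (u n) powr p n + b * norm (v n) powr p n"
      using assms p_gt_1 by (intro powr_convex_comb_le) auto
    finally show ?thesis .
  qed
  then have "ennreal (norm (w n) powr p n)
      \<le> ennreal a * ennreal (norm (u n) powr p n) + ennreal b * ennreal (norm (v n) powr p n)" for n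
    using assms by (simp add: ennreal_mult[symmetric] ennreal_plus[symmetric] ennreal_leI del: ennreal_plus)
  then show ?thesis
    unfolding exp_modular_def ennreal_suminf_cmult[symmetric]
    by (subst suminf_add) (auto intro!: suminf_le summableI)
qed

lemma modular_zero [simp]: "exp_modular p (\<lambda>n. 0) = 0"
  by (simp add: exp_modular_def)

text \<open>Convexity with the zero sequence, of modular 0, as second point.\<close>

lemma modular_scale_le_1:
  assumes "0 \<le> a" "a \<le> 1" "\<And>n. norm (w n) \<le> a * norm (u n)"
  shows "exp_modular p w \<le> ennreal a * exp_modular p u"
  using modular_convex[of a "1 - a" w u "\<lambda>n. 0"] assms by simp

section \<open>Linear structure of the variable exponent space\<close>

lemma exp_space_dominated:
  assumes "u \<in> exp_space p" "\<And>n. norm (v n) \<le> c * norm (u n)"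
  shows "v \<in> exp_space p"
proof -
  \<comment> \<open>The scaling estimate asks for a factor of at least 1.\<close>
  have "norm (v n) \<le> max 1 c * norm (u n)" for n
    using assms(2)[of n] by (meson max.cobounded2 mult_right_mono norm_ge_zero order_trans)
  then have "exp_modular p v \<le> ennreal (max 1 c powr M) * exp_modular p u"
    by (intro modular_scale_ge_1) auto
  also have "\<dots> < \<infinity>"
    using assms(1) by (simp add: exp_space_def ennreal_mult_less_top)
  finally show ?thesis by (simp add: exp_space_def)
qed

lemma exp_space_scale: "u \<in> exp_space p \<Longrightarrow> seq_scale k u \<in> exp_space p"
  by (rule exp_space_dominated[of u _ "norm k"]) (auto simp: seq_scale_def norm_mult)

lemma exp_space_add:
  assumes "u \<in> exp_space p" "v \<in> exp_space p"
  shows "u + v \<in> exp_space p"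
proof -
  \<comment> \<open>Convexity controls half of the sum; domination with factor 2 then recovers the
    sum itself.\<close>
  have "exp_modular p (\<lambda>n. (u n + v n) / 2)
      \<le> ennreal (1/2) * exp_modular p u + ennreal (1/2) * exp_modular p v"
  proof (intro modular_convex)
    show "norm ((u n + v n) / 2) \<le> 1/2 * norm (u n) + 1/2 * norm (v n)" for n
      using norm_triangle_ineq[of "u n" "v n"] by (simp add: norm_divide)
  qed auto
  also have "\<dots> < \<infinity>"
    using assms by (simp add: exp_space_def ennreal_mult_less_top del: ennreal_half)
  finally have "(\<lambda>n. (u n + v n) / 2) \<in> exp_space p" by (simp add: exp_space_def)
  then show ?thesis
    by (rule exp_space_dominated[where c = 2]) (simp add: norm_divide)
qed

lemma subspace_exp_space: "module.subspace seq_scale (exp_space p)"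
  unfolding subspace_seq_scale_iff
  by (auto simp: exp_space_scale exp_space_add) (simp add: exp_space_def zero_fun_def)

section \<open>The Luxemburg norm and the unit ball of the modular\<close>

lemma luxemburg_set_nonempty:
  assumes "u \<in> exp_space p"
  shows "\<exists>c>0. exp_modular p (\<lambda>n. u n / of_real c) \<le> 1"
proof -
  obtain R where R: "exp_modular p u = ennreal R" "0 \<le> R"
    using assms by (cases "exp_modular p u") (auto simp: exp_space_def)
  \<comment> \<open>Dividing by a number \<open>c \<ge> 1\<close> shrinks the modular to at most
    \<open>R / c\<close>, so \<open>c\<close> must also be at least \<open>R\<close>.\<close>
  define c where "c = max 1 R"
  have c: "1 \<le> c" "R \<le> c" by (auto simp: c_def)
  have "exp_modular p (\<lambda>n. u n / of_real c) \<le> ennreal (1 / c) * exp_modular p u"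
    using c by (intro modular_scale_le_1) (auto simp: norm_divide)
  also have "\<dots> = ennreal (R / c)"
    using c R by (simp add: ennreal_mult[symmetric])
  also have "\<dots> \<le> 1"
    using c R by (simp add: ennreal_le_1)
  finally show ?thesis using c by (intro exI[of _ c]) auto
qed

lemma exp_norm_le:
  assumes "0 < c" "exp_modular p (\<lambda>n. u n / of_real c) \<le> 1"
  shows "exp_norm p u \<le> c"
  unfolding exp_norm_def using assms by (intro cInf_lower bdd_belowI[of _ 0]) auto

lemma exp_norm_nonneg:
  assumes "u \<in> exp_space p"
  shows "0 \<le> exp_norm p u"
  unfolding exp_norm_def using luxemburg_set_nonempty[OF assms]
  by (intro cInf_greatest) auto

text \<open>The admissible constants are closed upwards, since a larger divisor gives a smaller
  modular; hence everything above the infimum is admissible.\<close>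

lemma modular_le_1_if_exp_norm_less:
  assumes "u \<in> exp_space p" "exp_norm p u < c"
  shows "exp_modular p (\<lambda>n. u n / of_real c) \<le> 1"
proof -
  obtain d where d: "0 < d" "exp_modular p (\<lambda>n. u n / of_real d) \<le> 1" "d < c"
    using cInf_lessD[of "{c. 0 < c \<and> exp_modular p (\<lambda>n. u n / of_real c) \<le> 1}" c]
      luxemburg_set_nonempty[OF assms(1)] assms(2) unfolding exp_norm_def by auto
  have "exp_modular p (\<lambda>n. u n / of_real c) \<le> exp_modular p (\<lambda>n. u n / of_real d)"
    using d by (intro modular_mono) (auto simp: norm_divide intro!: divide_left_mono)
  then show ?thesis using d by simp
qed

text \<open>Continuity of the coordinates, used for definiteness of the norm and for completeness: a
  modular of at most 1 bounds every coordinate by 1.\<close>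

lemma norm_le_exp_norm:
  assumes "u \<in> exp_space p"
  shows "norm (u n) \<le> exp_norm p u"
proof (rule dense_ge)
  fix c assume c: "exp_norm p u < c"
  then have "0 < c" using exp_norm_nonneg[OF assms] by simp
  then show "norm (u n) \<le> c"
    using norm_le_1_if_modular_le_1[OF modular_le_1_if_exp_norm_less[OF assms c], of n]
    by (simp add: norm_divide)
qed

lemma modular_eq_1_if_exp_norm_eq_1:
  assumes "u \<in> exp_space p" "exp_norm p u = 1"
  shows "exp_modular p u = 1"
proof -
  obtain R where R: "exp_modular p u = ennreal R" "0 \<le> R"
    using assms by (cases "exp_modular p u") (auto simp: exp_space_def)
  have "R \<le> c" if "1 < c" for c
  proof -
    \<comment> \<open>Chosen so that scaling back by \<open>d\<close> costs exactly the factor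
      \<open>d powr M = c\<close>, while \<open>d\<close> still exceeds the norm 1.\<close>
    define d where "d = c powr (1 / M)"
    have d: "1 < d" "d powr M = c"
      using that M_pos powr_less_mono2[of "1 / M" 1 c] by (auto simp: d_def powr_powr)
    have "ennreal R \<le> ennreal (d powr M) * exp_modular p (\<lambda>n. u n / of_real d)"
      unfolding R(1)[symmetric] using d by (intro modular_scale_ge_1) (auto simp: norm_divide)
    also have "\<dots> \<le> ennreal (d powr M) * 1"
      using d assms by (intro mult_left_mono modular_le_1_if_exp_norm_less) auto
    finally show ?thesis using d that by simp
  qed
  then have "R \<le> 1" by (rule dense_ge)
  moreover have "\<not> R < 1"
  proof
    assume "R < 1"
    \<comment> \<open>A modular below 1 leaves room to stretch \<open>u\<close> by some
      \<open>d > 1\<close>, contradicting norm 1. This \<open>c\<close> satisfies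
      \<open>1 < c\<close> and \<open>c * R \<le> 1\<close>, also when \<open>R = 0\<close>.\<close>
    define c where "c = 2 / (1 + R)"
    define d where "d = c powr (1 / M)"
    have c: "1 < c" "c * R \<le> 1" using \<open>R < 1\<close> R(2) by (auto simp: c_def field_simps)
    have d: "1 < d" "d powr M = c"
      using c M_pos powr_less_mono2[of "1 / M" 1 c] by (auto simp: d_def powr_powr)
    have "exp_modular p (\<lambda>n. u n / of_real (1 / d)) \<le> ennreal (d powr M) * exp_modular p u"
      using d by (intro modular_scale_ge_1) (auto simp: norm_mult)
    also have "\<dots> = ennreal (c * R)"
      using c d R by (simp add: ennreal_mult)
    also have "\<dots> \<le> 1" using c by (simp add: ennreal_le_1)
    finally have "exp_norm p u \<le> 1 / d" using d by (intro exp_norm_le) auto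
    then show False using d assms(2) by (simp add: field_simps)
  qed
  ultimately show ?thesis using R by (simp add: antisym)
qed

section \<open>The norm axioms\<close>

lemma exp_norm_zero [simp]: "exp_norm p 0 = 0"
proof (rule antisym)
  show "exp_norm p 0 \<le> 0"
    by (rule dense_ge, rule exp_norm_le) (auto simp: zero_fun_def)
  show "0 \<le> exp_norm p 0"
    by (rule exp_norm_nonneg) (simp add: exp_space_def zero_fun_def)
qed

lemma exp_norm_eq_0_iff:
  assumes "u \<in> exp_space p"
  shows "exp_norm p u = 0 \<longleftrightarrow> u = 0"
proof
  assume "exp_norm p u = 0"
  then show "u = 0" using norm_le_exp_norm[OF assms] by (simp add: fun_eq_iff)
qed simp

text \<open>If \<open>c\<close> exceeds the norm of \<open>u\<close>, then \<open>norm k * c\<close>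
  is admissible for the scaled sequence; let \<open>c\<close> decrease to the norm.\<close>

lemma exp_norm_scale_le:
  assumes "u \<in> exp_space p" "k \<noteq> 0"
  shows "exp_norm p (seq_scale k u) \<le> norm k * exp_norm p u"
proof -
  have "exp_norm p (seq_scale k u) / norm k \<le> c" if c: "exp_norm p u < c" for c
  proof -
    have "0 < c" using exp_norm_nonneg[OF assms(1)] c by simp
    have "exp_modular p (\<lambda>n. seq_scale k u n / of_real (norm k * c))
        \<le> exp_modular p (\<lambda>n. u n / of_real c)"
      using assms(2) \<open>0 < c\<close>
      by (intro modular_mono) (auto simp: seq_scale_def norm_mult norm_divide)
    also have "\<dots> \<le> 1" by (rule modular_le_1_if_exp_norm_less[OF assms(1) c])
    finally have "exp_norm p (seq_scale k u) \<le> norm k * c"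
      using assms(2) \<open>0 < c\<close> by (intro exp_norm_le) auto
    then show ?thesis using assms(2) by (simp add: field_simps)
  qed
  then have "exp_norm p (seq_scale k u) / norm k \<le> exp_norm p u" by (rule dense_ge)
  then show ?thesis using assms(2) by (simp add: field_simps)
qed

lemma exp_norm_scale:
  assumes "u \<in> exp_space p"
  shows "exp_norm p (seq_scale k u) = norm k * exp_norm p u"
proof (cases "k = 0")
  case True
  then have "seq_scale k u = 0" by (auto simp: seq_scale_def)
  then show ?thesis using True by simp
next
  case False
  \<comment> \<open>The reverse inequality is the same bound for the inverse scalar.\<close>
  have "exp_norm p (seq_scale (1 / k) (seq_scale k u)) \<le> norm (1 / k) * exp_norm p (seq_scale k u)"
    using False assms exp_space_scale by (intro exp_norm_scale_le) auto
  moreover have "seq_scale (1 / k) (seq_scale k u) = u"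
    using False by (auto simp: seq_scale_def)
  ultimately have "norm k * exp_norm p u \<le> exp_norm p (seq_scale k u)"
    using False by (simp add: norm_divide field_simps)
  then show ?thesis using exp_norm_scale_le[OF assms False] by simp
qed

lemma exp_norm_triangle:
  assumes "u \<in> exp_space p" "v \<in> exp_space p"
  shows "exp_norm p (u + v) \<le> exp_norm p u + exp_norm p v"
proof (rule field_le_epsilon)
  fix e :: real assume "0 < e"
  \<comment> \<open>The margin \<open>e / 2\<close> makes \<open>c\<close> and \<open>d\<close>
    positive and admissible. Then \<open>(u + v) / (c + d)\<close> is the convex combination of
    \<open>u / c\<close> and \<open>v / d\<close> with weights \<open>c / (c + d)\<close> and
    \<open>d / (c + d)\<close>.\<close>
  define c where "c = exp_norm p u + e / 2"
  define d where "d = exp_norm p v + e / 2"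
  have c: "0 < c" "exp_norm p u < c" and d: "0 < d" "exp_norm p v < d"
    using \<open>0 < e\<close> exp_norm_nonneg[OF assms(1)] exp_norm_nonneg[OF assms(2)]
    by (auto simp: c_def d_def)
  have "exp_modular p (\<lambda>n. (u + v) n / of_real (c + d))
      \<le> ennreal (c / (c + d)) * exp_modular p (\<lambda>n. u n / of_real c)
        + ennreal (d / (c + d)) * exp_modular p (\<lambda>n. v n / of_real d)"
  proof (rule modular_convex)
    show "0 \<le> c / (c + d)" "0 \<le> d / (c + d)" using c d by auto
    show "c / (c + d) + d / (c + d) = 1"
      using c d by (simp add: add_divide_distrib[symmetric])
    show "norm ((u + v) n / of_real (c + d))
        \<le> c / (c + d) * norm (u n / of_real c) + d / (c + d) * norm (v n / of_real d)" for n
    proof -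
      have "norm ((u + v) n / of_real (c + d)) = norm (u n + v n) / (c + d)"
        using c d by (simp only: norm_divide norm_of_real plus_fun_apply)
      also have "\<dots> \<le> (norm (u n) + norm (v n)) / (c + d)"
        using c d norm_triangle_ineq by (intro divide_right_mono) auto
      also have "\<dots> = c / (c + d) * norm (u n / of_real c) + d / (c + d) * norm (v n / of_real d)"
        using c d by (simp add: norm_divide add_divide_distrib)
      finally show ?thesis .
    qed
  qed
  also have "\<dots> \<le> ennreal (c / (c + d)) * 1 + ennreal (d / (c + d)) * 1"
    using c d assms by (intro add_mono mult_left_mono modular_le_1_if_exp_norm_less) auto
  also have "\<dots> = 1"
    using c d by (simp add: ennreal_plus[symmetric] add_divide_distrib[symmetric] del: ennreal_plus)
  finally have "exp_norm p (u + v) \<le> c + d"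
    using c d by (intro exp_norm_le) auto
  then show "exp_norm p (u + v) \<le> exp_norm p u + exp_norm p v + e"
    by (simp add: c_def d_def)
qed

lemma normed_space_exp: "normed_space_on seq_scale (exp_space p) (exp_norm p)"
  unfolding normed_space_on_def
  using vector_space_seq_scale subspace_exp_space exp_norm_nonneg exp_norm_eq_0_iff
    exp_norm_scale exp_norm_triangle by blast

lemma exp_space_diff: "u \<in> exp_space p \<Longrightarrow> v \<in> exp_space p \<Longrightarrow> u - v \<in> exp_space p"
  using exp_space_add[of u "seq_scale (- 1) v"] exp_space_scale[of v "- 1"]
  by (simp add: seq_scale_def plus_fun_def fun_diff_def)

section \<open>Completeness\<close>

lemma modular_limit_le_1:
  assumes "\<And>n. (\<lambda>j. V j n) \<longlonglongrightarrow> v n" "\<And>j. j \<ge> K \<Longrightarrow> exp_modular p (V j) \<le> 1"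
  shows "exp_modular p v \<le> 1"
proof -
  \<comment> \<open>Fatou's argument: the bound passes to the limit in each finite partial sum,
    hence to the whole series.\<close>
  have "(\<Sum>n<m. norm (v n) powr p n) \<le> 1" for m
  proof (rule LIMSEQ_le_const2)
    show "(\<lambda>j. \<Sum>n<m. norm (V j n) powr p n) \<longlonglongrightarrow> (\<Sum>n<m. norm (v n) powr p n)"
      using p_pos by (intro tendsto_sum tendsto_powr2 tendsto_norm assms(1) tendsto_const) auto
    have "(\<Sum>n<m. norm (V j n) powr p n) \<le> 1" if "j \<ge> K" for j
    proof -
      have "ennreal (\<Sum>n<m. norm (V j n) powr p n) = (\<Sum>n<m. ennreal (norm (V j n) powr p n))"
        by (simp add: sum_ennreal)
      also have "\<dots> \<le> exp_modular p (V j)"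
        unfolding exp_modular_def by (rule sum_le_suminf) (auto intro: summableI)
      also have "\<dots> \<le> 1" using assms(2) that by simp
      finally show ?thesis by (simp add: ennreal_le_1)
    qed
    then show "\<exists>N. \<forall>j\<ge>N. (\<Sum>n<m. norm (V j n) powr p n) \<le> 1" by blast
  qed
  then have "(\<Sum>n<m. ennreal (norm (v n) powr p n)) \<le> 1" for m
    by (simp add: sum_ennreal ennreal_le_1)
  then show ?thesis
    unfolding exp_modular_def by (intro suminf_le_const summableI)
qed

lemma exp_complete:
  fixes X :: "nat \<Rightarrow> nat \<Rightarrow> 'a::{real_normed_field,banach}"
  assumes X: "\<And>i. X i \<in> exp_space p"
    and Cauchy: "\<And>e. 0 < e \<Longrightarrow> \<exists>K. \<forall>i\<ge>K. \<forall>j\<ge>K. exp_norm p (X i - X j) < e"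
  shows "\<exists>x\<in>exp_space p. (\<lambda>i. exp_norm p (X i - x)) \<longlonglongrightarrow> 0"
proof -
  have "\<exists>l. (\<lambda>i. X i n) \<longlonglongrightarrow> l" for n
  proof -
    have "Cauchy (\<lambda>i. X i n)"
    proof (rule metric_CauchyI)
      fix e :: real assume "0 < e"
      then obtain K where K: "\<forall>i\<ge>K. \<forall>j\<ge>K. exp_norm p (X i - X j) < e" using Cauchy by blast
      have "dist (X i n) (X j n) < e" if "i \<ge> K" "j \<ge> K" for i j
      proof -
        have "dist (X i n) (X j n) \<le> exp_norm p (X i - X j)"
          using norm_le_exp_norm[OF exp_space_diff[OF X X], of i j n] by (simp add: dist_norm)
        also have "\<dots> < e" using K that by blast
        finally show ?thesis .
      qed
      then show "\<exists>K. \<forall>i\<ge>K. \<forall>j\<ge>K. dist (X i n) (X j n) < e" by blast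
    qed
    then show ?thesis using Cauchy_convergent_iff convergent_def by blast
  qed
  then obtain x where x: "\<And>n. (\<lambda>i. X i n) \<longlonglongrightarrow> x n" by metis
  \<comment> \<open>The limit is so far only coordinatewise. Fixing \<open>i\<close> and letting
    \<open>j\<close> tend to infinity in the Cauchy estimate makes it uniform in the
    modular.\<close>
  have close: "\<exists>K. \<forall>i\<ge>K. exp_modular p (\<lambda>n. (X i - x) n / of_real e) \<le> 1" if "0 < e" for e
  proof -
    obtain K where K: "\<forall>i\<ge>K. \<forall>j\<ge>K. exp_norm p (X i - X j) < e" using Cauchy \<open>0 < e\<close> by blast
    have "exp_modular p (\<lambda>n. (X i - x) n / of_real e) \<le> 1" if "i \<ge> K" for i
    proof (rule modular_limit_le_1)
      show "(\<lambda>j. (X i - X j) n / of_real e) \<longlonglongrightarrow> (X i - x) n / of_real e" for n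
        using \<open>0 < e\<close> by (auto intro!: tendsto_intros x)
      show "exp_modular p (\<lambda>n. (X i - X j) n / of_real e) \<le> 1" if "j \<ge> K" for j
        by (rule modular_le_1_if_exp_norm_less[OF exp_space_diff[OF X X]])
          (use K \<open>i \<ge> K\<close> that in blast)
    qed
    then show ?thesis by blast
  qed
  have "x \<in> exp_space p"
  proof -
    obtain K where "exp_modular p (\<lambda>n. (X K - x) n / of_real 1) \<le> 1" using close[of 1] by auto
    then have "X K - x \<in> exp_space p"
      by (auto simp: exp_space_def fun_diff_def intro: le_less_trans)
    then show ?thesis using exp_space_diff[OF X[of K], of "X K - x"] by simp
  qed
  moreover have "(\<lambda>i. exp_norm p (X i - x)) \<longlonglongrightarrow> 0"
  proof (rule LIMSEQ_I)
    fix e :: real assume "0 < e"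
    \<comment> \<open>Admissibility of a constant bounds the norm only weakly; \<open>e / 2\<close>
      makes the final inequality strict.\<close>
    then obtain K where K: "\<forall>i\<ge>K. exp_modular p (\<lambda>n. (X i - x) n / of_real (e / 2)) \<le> 1"
      using close[of "e / 2"] by auto
    have "norm (exp_norm p (X i - x) - 0) < e" if "i \<ge> K" for i
    proof -
      have "exp_norm p (X i - x) \<le> e / 2"
        using K that \<open>0 < e\<close> by (intro exp_norm_le) auto
      then show ?thesis
        using exp_norm_nonneg[OF exp_space_diff[OF X \<open>x \<in> exp_space p\<close>], of i] \<open>0 < e\<close> by simp
    qed
    then show "\<exists>K. \<forall>i\<ge>K. norm (exp_norm p (X i - x) - 0) < e" by blast
  qed
  ultimately show ?thesis by blast
qed

section \<open>Strict convexity of the modular and rotundity\<close>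

lemma modular_midpoint_less:
  fixes y z :: "nat \<Rightarrow> 'a::{real_normed_field,real_inner}"
  assumes "y \<in> exp_space p" "z \<in> exp_space p" "y \<noteq> z"
  shows "2 * exp_modular p (\<lambda>n. (y n + z n) / 2) < exp_modular p y + exp_modular p z"
proof -
  define a b c where "a n = norm (y n) powr p n" and "b n = norm (z n) powr p n"
    and "c n = norm ((y n + z n) / 2) powr p n" for n
  have nonneg: "0 \<le> a n" "0 \<le> b n" "0 \<le> c n" for n
    by (auto simp: a_def b_def c_def)
  have modular: "exp_modular p y = (\<Sum>n. ennreal (a n))" "exp_modular p z = (\<Sum>n. ennreal (b n))"
    "exp_modular p (\<lambda>n. (y n + z n) / 2) = (\<Sum>n. ennreal (c n))"
    by (simp_all only: exp_modular_def a_def b_def c_def)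
  have "(\<Sum>n. ennreal (a n)) \<noteq> top" "(\<Sum>n. ennreal (b n)) \<noteq> top"
    using assms(1,2) by (auto simp: exp_space_def modular)
  \<comment> \<open>Strictness in one term survives summation only when the sums are finite, so the
    comparison is made between convergent real series.\<close>
  then have sm: "summable a" "summable b"
    using nonneg by (auto intro: summable_suminf_not_top)
  have less: "c n < (a n + b n) / 2" if "y n \<noteq> z n" for n
    unfolding a_def b_def c_def using that p_gt_1 by (intro norm_powr_midpoint_less) auto
  have le: "c n \<le> (a n + b n) / 2" for n
  proof (cases "y n = z n")
    case True
    then show ?thesis by (simp add: a_def b_def c_def norm_divide norm_mult flip: mult_2)
  next
    case False
    then show ?thesis using less by (simp add: less_imp_le)
  qed
  have smc: "summable c"
    by (rule summable_comparison_test'[OF summable_divide[OF summable_add[OF sm], of 2], of 0])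
      (use le nonneg in auto)
  obtain m where "y m \<noteq> z m" using assms(3) by blast
  \<comment> \<open>All terms are nonnegative by midpoint convexity, and the term at
    \<open>m\<close> is positive.\<close>
  then have "0 < (\<Sum>n. a n + b n - 2 * c n)"
    using sm smc le less[of m]
    by (intro suminf_pos2[of _ m] summable_diff summable_add summable_mult) (auto simp: field_simps)
  also have "\<dots> = suminf a + suminf b - 2 * suminf c"
    using sm smc by (simp add: suminf_diff[symmetric] suminf_add[symmetric] suminf_mult
        summable_add summable_mult)
  finally have "2 * suminf c < suminf a + suminf b" by simp
  moreover have "exp_modular p y = ennreal (suminf a)" "exp_modular p z = ennreal (suminf b)"
    "exp_modular p (\<lambda>n. (y n + z n) / 2) = ennreal (suminf c)"
    using sm smc nonneg by (simp_all add: modular suminf_ennreal2)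
  moreover have "0 \<le> suminf a" "0 \<le> suminf b" "0 \<le> suminf c"
    using sm smc nonneg by (simp_all add: suminf_nonneg)
  moreover have "2 * ennreal (suminf c) = ennreal (2 * suminf c)"
    by (simp add: ennreal_mult')
  ultimately show ?thesis
    by (simp add: ennreal_less_iff flip: ennreal_plus)
qed

text \<open>On the unit sphere all three modulars equal 1, so \<open>y \<noteq> z\<close> would give
  \<open>2 < 2\<close>. The sort \<open>euclidean_space\<close> supplies both the complete scalars
  for \<open>exp_complete\<close> and the inner product for
  \<open>modular_midpoint_less\<close>.\<close>

lemma rotund_exp:
  "rotund_on (seq_scale :: 'a::{real_normed_field,euclidean_space} \<Rightarrow> _) (exp_space p) (exp_norm p)"
  unfolding rotund_on_def banach_space_on_def extreme_point_on_def
proof (intro conjI ballI allI impI)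
  fix x y z :: "nat \<Rightarrow> 'a"
  assume sph: "x \<in> unit_sphere_on (exp_space p) (exp_norm p)"
    "y \<in> unit_sphere_on (exp_space p) (exp_norm p)" "z \<in> unit_sphere_on (exp_space p) (exp_norm p)"
    and mid: "x = seq_scale (1 / 2) (y + z)"
  have "x = (\<lambda>n. (y n + z n) / 2)" using mid by (auto simp: seq_scale_def)
  moreover have "exp_modular p x = 1" "exp_modular p y = 1" "exp_modular p z = 1"
    using sph modular_eq_1_if_exp_norm_eq_1 by (auto simp: unit_sphere_on_def)
  ultimately show "y = z"
    using modular_midpoint_less[of y z] sph by (auto simp: unit_sphere_on_def)
qed (use normed_space_exp exp_complete in blast)+

end

section \<open>Transfer along linear bijections\<close>

text \<open>\<open>T\<close> is an isometric isomorphism for the pulled back norm. Surjectivity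
  pulls limits back; injectivity gives definiteness of the norm and returns \<open>T y = T z\<close>
  to \<open>y = z\<close>.\<close>

lemma rotund_on_vimage:
  fixes smul :: "'k::real_normed_field \<Rightarrow> 'v::ab_group_add \<Rightarrow> 'v"
  assumes rot: "rotund_on smul Y N" and bij: "bij T"
    and add: "\<And>x y. T (x + y) = T x + T y" and scale: "\<And>c x. T (smul c x) = smul c (T x)"
  shows "rotund_on smul (T -` Y) (N \<circ> T)"
proof -
  have ban: "banach_space_on smul Y N"
    and ext: "\<And>x. x \<in> unit_sphere_on Y N \<Longrightarrow> extreme_point_on smul Y N x"
    using rot by (auto simp: rotund_on_def)
  have nrm: "normed_space_on smul Y N" using ban by (simp add: banach_space_on_def)
  then interpret vector_space smul by (simp add: normed_space_on_def)
  have T0: "T 0 = 0" using add[of 0 0] by simp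
  have T0_iff: "T x = 0 \<longleftrightarrow> x = 0" for x
    using T0 bij_is_inj[OF bij] by (metis injD)
  have diff: "T (x - y) = T x - T y" for x y
    using add[of "x - y" y] by simp
  have "subspace (T -` Y)"
    using nrm by (auto simp: normed_space_on_def subspace_def T0 add scale)
  then have "normed_space_on smul (T -` Y) (N \<circ> T)"
    using nrm by (auto simp: normed_space_on_def T0_iff add scale)
  moreover have "\<exists>x\<in>T -` Y. (\<lambda>i. (N \<circ> T) (X i - x)) \<longlonglongrightarrow> 0"
    if X: "\<forall>i. X i \<in> T -` Y" "\<forall>e>0. \<exists>K. \<forall>i\<ge>K. \<forall>j\<ge>K. (N \<circ> T) (X i - X j) < e" for X :: "nat \<Rightarrow> 'v"
  proof -
    have "\<exists>y\<in>Y. (\<lambda>i. N (T (X i) - y)) \<longlonglongrightarrow> 0"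
      using ban X by (simp add: banach_space_on_def diff)
    then obtain y where y: "y \<in> Y" "(\<lambda>i. N (T (X i) - y)) \<longlonglongrightarrow> 0" by blast
    obtain x where "y = T x" using bij_is_surj[OF bij] by blast
    then show ?thesis using y by (intro bexI[of _ x]) (auto simp: diff)
  qed
  ultimately have "banach_space_on smul (T -` Y) (N \<circ> T)"
    by (simp add: banach_space_on_def)
  moreover have "extreme_point_on smul (T -` Y) (N \<circ> T) x"
    if x: "x \<in> unit_sphere_on (T -` Y) (N \<circ> T)" for x
  proof -
    have "y = z" if "y \<in> unit_sphere_on (T -` Y) (N \<circ> T)" "z \<in> unit_sphere_on (T -` Y) (N \<circ> T)"
      "x = smul (1 / 2) (y + z)" for y z
    proof -
      have "T x \<in> unit_sphere_on Y N" "T y \<in> unit_sphere_on Y N" "T z \<in> unit_sphere_on Y N"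
        using x that by (auto simp: unit_sphere_on_def)
      moreover have "T x = smul (1 / 2) (T y + T z)"
        using that(3) by (simp add: add scale)
      ultimately have "T y = T z"
        using ext[of "T x"] unfolding extreme_point_on_def by blast
      then show ?thesis using bij_is_inj[OF bij] by (metis injD)
    qed
    then show ?thesis using x unfolding extreme_point_on_def by blast
  qed
  ultimately show ?thesis by (simp add: rotund_on_def)
qed

section \<open>Triangular matrices\<close>

text \<open>Solves a lower triangular system row by row. Its equation leaves the simplifier because
  the recursive call under the sum would unfold forever.\<close>

fun forward_subst :: "(nat \<Rightarrow> nat \<Rightarrow> 'a::field) \<Rightarrow> (nat \<Rightarrow> 'a) \<Rightarrow> nat \<Rightarrow> 'a" where
  "forward_subst a y n = (y n - (\<Sum>k<n. a n k * forward_subst a y k)) / a n n"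

declare forward_subst.simps [simp del]

text \<open>Row \<open>n\<close> determines entry \<open>n\<close> from the earlier ones, as the
  diagonal entry is invertible: strong induction gives injectivity, forward substitution
  surjectivity.\<close>

lemma bij_triangular:
  fixes a :: "nat \<Rightarrow> nat \<Rightarrow> 'a::field"
  assumes diag: "\<And>n. a n n \<noteq> 0"
  shows "bij (\<lambda>x n. \<Sum>k\<le>n. a n k * x k)"
proof (rule bijI)
  have split: "(\<Sum>k\<le>n. a n k * x k) = (\<Sum>k<n. a n k * x k) + a n n * x n" for x n
    by (simp add: lessThan_Suc_atMost[symmetric])
  show "inj (\<lambda>x n. \<Sum>k\<le>n. a n k * x k)"
  proof (rule injI, rule ext)
    fix x y n
    assume eq: "(\<lambda>n. \<Sum>k\<le>n. a n k * x k) = (\<lambda>n. \<Sum>k\<le>n. a n k * y k)"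
    show "x n = y n"
    proof (induction n rule: less_induct)
      case (less n)
      have "(\<Sum>k<n. a n k * x k) = (\<Sum>k<n. a n k * y k)"
        using less by (intro sum.cong) auto
      then show ?case using fun_cong[OF eq, of n] diag[of n] by (simp add: split)
    qed
  qed
  show "surj (\<lambda>x n. \<Sum>k\<le>n. a n k * x k)"
  proof (rule surjI[of _ "forward_subst a"], rule ext)
    fix y n
    show "(\<Sum>k\<le>n. a n k * forward_subst a y k) = y n"
      using diag[of n] by (simp add: split forward_subst.simps[of a y n])
  qed
qed

text \<open>Partial sums invert differences by telescoping; the convention that the entry before
  index 0 is 0 fixes the constant of summation.\<close>

lemma bij_seq_diff: "bij (seq_diff :: (nat \<Rightarrow> 'a::ab_group_add) \<Rightarrow> _)"
proof (rule bijI)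
  show "inj (seq_diff :: (nat \<Rightarrow> 'a) \<Rightarrow> _)"
  proof (rule injI, rule ext)
    fix x y :: "nat \<Rightarrow> 'a" and n
    assume eq: "seq_diff x = seq_diff y"
    show "x n = y n"
    proof (induction n)
      case 0
      then show ?case using fun_cong[OF eq, of 0] by (simp add: seq_diff_def)
    next
      case (Suc n)
      then show ?case using fun_cong[OF eq, of "Suc n"] by (simp add: seq_diff_def)
    qed
  qed
  show "surj (seq_diff :: (nat \<Rightarrow> 'a) \<Rightarrow> _)"
  proof (rule surjI[of _ "\<lambda>y n. \<Sum>k\<le>n. y k"], rule ext)
    show "seq_diff (\<lambda>n. \<Sum>k\<le>n. y k) n = y n" for y :: "nat \<Rightarrow> 'a" and n
      by (cases n) (auto simp: seq_diff_def)
  qed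
qed

section \<open>The operator that carries the sequence space onto the variable exponent space\<close>

definition l_operator ::
  "(nat \<Rightarrow> 'a::field) \<Rightarrow> (nat \<Rightarrow> 'a) \<Rightarrow> (nat \<Rightarrow> 'a) \<Rightarrow> (nat \<Rightarrow> 'a) \<Rightarrow> nat \<Rightarrow> 'a" where
  "l_operator r s t x n = 1 / r n * (\<Sum>k=0..n. s (n - k) * t k * seq_diff x k)"

lemma bij_l_operator:
  assumes "r \<in> seq_U" "t \<in> seq_U" "s \<in> seq_U0"
  shows "bij (l_operator r s t)"
proof -
  \<comment> \<open>The diagonal entry is \<open>1 / r n * s 0 * t n\<close>, nonzero by the three
    assumptions.\<close>
  have "bij (\<lambda>x n. \<Sum>k\<le>n. 1 / r n * s (n - k) * t k * x k)"
    using assms by (intro bij_triangular) (auto simp: seq_U_def seq_U0_def)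
  then have "bij ((\<lambda>x n. \<Sum>k\<le>n. 1 / r n * s (n - k) * t k * x k) \<circ> seq_diff)"
    by (rule bij_comp[OF bij_seq_diff])
  moreover have "(\<lambda>x n. \<Sum>k\<le>n. 1 / r n * s (n - k) * t k * x k) \<circ> seq_diff = l_operator r s t"
    by (auto simp: fun_eq_iff l_operator_def sum_distrib_left atMost_atLeast0 mult.assoc)
  ultimately show ?thesis by simp
qed

lemma l_operator_add: "l_operator r s t (x + y) = l_operator r s t x + l_operator r s t y"
proof -
  have "seq_diff (x + y) k = seq_diff x k + seq_diff y k" for k
    by (simp add: seq_diff_def)
  then show ?thesis by (auto simp: l_operator_def fun_eq_iff ring_distribs sum.distrib)
qed

lemma l_operator_scale: "l_operator r s t (seq_scale c x) = seq_scale c (l_operator r s t x)"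
proof -
  have "seq_diff (seq_scale c x) k = c * seq_diff x k" for k
    by (simp add: seq_diff_def seq_scale_def right_diff_distrib)
  then show ?thesis
    by (auto simp: l_operator_def seq_scale_def fun_eq_iff sum_distrib_left mult_ac)
qed

lemma modular_p_eq: "modular_p r s t p x = exp_modular p (l_operator r s t x)"
  by (simp add: modular_p_def exp_modular_def l_operator_def)

lemma l_space_eq: "l_space r s t p = l_operator r s t -` exp_space p"
  by (auto simp: l_space_def exp_space_def modular_p_eq)

text \<open>By homogeneity, division by \<open>c\<close> commutes with the operator, so both infima
  are taken over the same set of constants.\<close>

lemma luxemburg_norm_eq:
  fixes r s t :: "nat \<Rightarrow> 'a::real_normed_field"
  shows "luxemburg_norm r s t p = exp_norm p \<circ> l_operator r s t"
proof
  fix x :: "nat \<Rightarrow> 'a"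
  have "(\<lambda>k. x k / of_real c) = seq_scale (1 / of_real c) x" for c
    by (simp add: seq_scale_def fun_eq_iff)
  then have "modular_p r s t p (\<lambda>k. x k / of_real c)
      = exp_modular p (\<lambda>n. l_operator r s t x n / of_real c)" for c
    by (simp add: modular_p_eq l_operator_scale) (simp add: seq_scale_def)
  then show "luxemburg_norm r s t p x = (exp_norm p \<circ> l_operator r s t) x"
    by (simp add: luxemburg_norm_def exp_norm_def)
qed

theorem theorem5p2:
  fixes r s t :: "nat \<Rightarrow> 'a::{real_normed_field,euclidean_space}"
    and p :: "nat \<Rightarrow> real"
  assumes "r \<in> seq_U" and "t \<in> seq_U" and "s \<in> seq_U0"
    and "bounded (range p)" and "\<And>n. 0 < p n"
    and "\<And>n. 1 < p n"
  shows "rotund_on seq_scale (l_space r s t p) (luxemburg_norm r s t p)"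
proof -
  obtain M where "\<And>n. \<bar>p n\<bar> \<le> M"
    using assms(4) by (auto simp: bounded_iff)
  then interpret bounded_exponent p M
    using assms(6) by unfold_locales (auto intro: order_trans[OF abs_ge_self])
  show ?thesis
    unfolding l_space_eq luxemburg_norm_eq
    using rotund_exp bij_l_operator[OF assms(1-3)] l_operator_add l_operator_scale
    by (rule rotund_on_vimage)
qed

end
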